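(* Let $\Omega\subseteq\mathbb{H}$ be a symmetric slice domain. A function $f:\Omega\to\mathbb{H}$ is regular if, and only if, it is symmetrically analytic.
   Context: $\mathbb{H}$ is the real algebra of quaternions; $\mathbb{N}=\{0,1,2,\dots\}$; $\mathbb{S}=\{q\in\mathbb{H}:q^2=-1\}$; for $I\in\mathbb{S}$, $L_I=\mathbb{R}+I\mathbb{R}\simeq\mathbb{C}$. For a domain (connected open set) $\Omega\subseteq\mathbb{H}$ and $f:\Omega\to\mathbb{H}$, put $\Omega_I=\Omega\cap L_I$, $f_I=f|_{\Omega_I}$. The function $f$ is (slice) regular if for every $I\in\mathbb{S}$ the restriction $f_I$ is holomorphic, i.e. $\frac12\left(\frac{\partial}{\partial x}+I\frac{\partial}{\partial y}\right)f_I(x+Iy)=0$ identically on $\Omega_I$. A domain $\Omega$ is a slice domain if it intersects the real axis and $\Omega_I$ is a domain in $L_I$ for all $I\in\mathbb{S}$; it is symmetric if $x+Iy\in\Omega$ (with $x,y\in\mathbb{R}$, $I\in\mathbb{S}$) implies $x+y\mathbb{S}=\{x+yJ:J\in\mathbb{S}\}\subseteq\Omega$. A function $f:\Omega\to\mathbb{H}$ on a symmetric slice domain is symmetrically analytic if at every $q_0=x_0+Iy_0\in\Omega$ ($x_0,y_0\in\mathbb{R}$, $I\in\mathbb{S}$) it admits an expansion $f(q)=\sum_{n\in\mathbb{N}}P_n(q)A_n$ with coefficients $A_n\in\mathbb{H}$ (depending on $q_0$), valid in a (Euclidean) neighborhood of $q_0$, where $P_{2n}(q)=[(q-x_0)^2+y_0^2]^n$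 and $P_{2n+1}(q)=[(q-x_0)^2+y_0^2]^n(q-q_0)$ for all $n\in\mathbb{N}$. *)

theory Defs
  imports "HOL-Analysis.Analysis"
begin

section \<open>The real algebra of quaternions\<close>

text \<open>
  \<open>Quat a b c d\<close> stands for \<open>a + b i + c j + d k\<close>. As for \<^typ>\<open>complex\<close>, \<open>codatatype\<close> is used
  only to have \<open>primcorec\<close> available for componentwise definitions.
\<close>

codatatype quat = Quat (qRe: real) (qIm1: real) (qIm2: real) (qIm3: real)

lemma quat_eq_iff:
  "x = y \<longleftrightarrow> qRe x = qRe y \<and> qIm1 x = qIm1 y \<and> qIm2 x = qIm2 y \<and> qIm3 x = qIm3 y"
  by (auto intro: quat.expand)

instantiation quat :: ab_group_add
begin

primcorec zero_quat where
  "qRe 0 = 0"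
| "qIm1 0 = 0"
| "qIm2 0 = 0"
| "qIm3 0 = 0"

primcorec plus_quat where
  "qRe (x + y) = qRe x + qRe y"
| "qIm1 (x + y) = qIm1 x + qIm1 y"
| "qIm2 (x + y) = qIm2 x + qIm2 y"
| "qIm3 (x + y) = qIm3 x + qIm3 y"

primcorec uminus_quat where
  "qRe (- x) = - qRe x"
| "qIm1 (- x) = - qIm1 x"
| "qIm2 (- x) = - qIm2 x"
| "qIm3 (- x) = - qIm3 x"

primcorec minus_quat where
  "qRe (x - y) = qRe x - qRe y"
| "qIm1 (x - y) = qIm1 x - qIm1 y"
| "qIm2 (x - y) = qIm2 x - qIm2 y"
| "qIm3 (x - y) = qIm3 x - qIm3 y"

instance
  by standard (simp_all add: quat_eq_iff)

end

instantiation quat :: ring_1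
begin

primcorec one_quat where
  "qRe 1 = 1"
| "qIm1 1 = 0"
| "qIm2 1 = 0"
| "qIm3 1 = 0"

primcorec times_quat where
  "qRe (x * y) = qRe x * qRe y - qIm1 x * qIm1 y - qIm2 x * qIm2 y - qIm3 x * qIm3 y"
| "qIm1 (x * y) = qRe x * qIm1 y + qIm1 x * qRe y + qIm2 x * qIm3 y - qIm3 x * qIm2 y"
| "qIm2 (x * y) = qRe x * qIm2 y - qIm1 x * qIm3 y + qIm2 x * qRe y + qIm3 x * qIm1 y"
| "qIm3 (x * y) = qRe x * qIm3 y + qIm1 x * qIm2 y - qIm2 x * qIm1 y + qIm3 x * qRe y"

instance
  by standard (simp_all add: quat_eq_iff algebra_simps)

end

instantiation quat :: real_algebra_1
begin

primcorec scaleR_quat where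
  "qRe (scaleR r x) = r * qRe x"
| "qIm1 (scaleR r x) = r * qIm1 x"
| "qIm2 (scaleR r x) = r * qIm2 x"
| "qIm3 (scaleR r x) = r * qIm3 x"

instance
  by standard (simp_all add: quat_eq_iff algebra_simps)

end

instantiation quat :: real_inner
begin

definition inner_quat :: "quat \<Rightarrow> quat \<Rightarrow> real" where
  "inner_quat x y = qRe x * qRe y + qIm1 x * qIm1 y + qIm2 x * qIm2 y + qIm3 x * qIm3 y"

definition norm_quat :: "quat \<Rightarrow> real" where
  "norm_quat x = sqrt (inner x x)"

definition sgn_quat :: "quat \<Rightarrow> quat" where
  "sgn_quat x = x /\<^sub>R norm x"

definition dist_quat :: "quat \<Rightarrow> quat \<Rightarrow> real" where
  "dist_quat x y = norm (x - y)"

definition uniformity_quat :: "(quat \<times> quat) filter" where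
  "uniformity_quat = (INF e\<in>{0 <..}. principal {(x, y). dist x y < e})"

definition open_quat :: "quat set \<Rightarrow> bool" where
  "open_quat U \<longleftrightarrow> (\<forall>x\<in>U. eventually (\<lambda>(x', y). x' = x \<longrightarrow> y \<in> U) uniformity)"

instance
proof
  fix x y z :: quat and r :: real
  show "inner x y = inner y x"
    by (simp add: inner_quat_def algebra_simps)
  show "inner (x + y) z = inner x z + inner y z"
    by (simp add: inner_quat_def algebra_simps)
  show "inner (scaleR r x) y = r * inner x y"
    by (simp add: inner_quat_def algebra_simps)
  show "0 \<le> inner x x"
    by (simp add: inner_quat_def)
  show "inner x x = 0 \<longleftrightarrow> x = 0"
    by (simp add: inner_quat_def quat_eq_iff add_nonneg_eq_0_iff)
qed (rule norm_quat_def sgn_quat_def dist_quat_def uniformity_quat_def open_quat_def)+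

end

instantiation quat :: inverse
begin

text \<open>The inverse of \<open>x\<close> is its conjugate divided by its squared norm.\<close>

definition inverse_quat :: "quat \<Rightarrow> quat" where
  "inverse x = Quat (qRe x) (- qIm1 x) (- qIm2 x) (- qIm3 x) /\<^sub>R inner x x"

definition divide_quat :: "quat \<Rightarrow> quat \<Rightarrow> quat" where
  "x div y = x * inverse y" for x y :: quat

instance ..

end

instance quat :: real_normed_div_algebra
proof
  fix x y :: quat
  show "inverse x * x = 1" if "x \<noteq> 0"
  proof -
    have "inner x x \<noteq> 0"
      using that by simp
    then show ?thesis
      unfolding quat_eq_iff inverse_quat_def
      by (simp add: inner_quat_def divide_simps algebra_simps)
  qed
  show "x * inverse x = 1" if "x \<noteq> 0"
  proof -
    have "inner x x \<noteq> 0"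
      using that by simp
    then show ?thesis
      unfolding quat_eq_iff inverse_quat_def
      by (simp add: inner_quat_def divide_simps algebra_simps)
  qed
  show "x / y = x * inverse y"
    by (rule divide_quat_def)
  show "inverse (0 :: quat) = 0"
    by (simp add: inverse_quat_def inner_quat_def)
  show "norm (x * y) = norm x * norm y"
    unfolding norm_quat_def real_sqrt_mult[symmetric]
    by (simp add: inner_quat_def algebra_simps)
qed

instantiation quat :: euclidean_space
begin

definition Basis_quat :: "quat set" where
  "Basis_quat = {Quat 1 0 0 0, Quat 0 1 0 0, Quat 0 0 1 0, Quat 0 0 0 1}"

instance
proof
  fix u v x :: quat
  show "(Basis :: quat set) \<noteq> {}" "finite (Basis :: quat set)"
    by (simp_all add: Basis_quat_def)
  show "inner u v = (if u = v then 1 else 0)" if "u \<in> Basis" "v \<in> Basis"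
    using that unfolding Basis_quat_def inner_quat_def
    by (elim insertE emptyE) simp_all
  show "(\<forall>u\<in>Basis. inner x u = 0) \<longleftrightarrow> x = 0"
    unfolding Basis_quat_def quat_eq_iff by (simp add: inner_quat_def)
qed

end


section \<open>Slices and domains\<close>

definition imag_units :: "quat set" where
  "imag_units = {q. q\<^sup>2 = - 1}"

definition slice_point :: "quat \<Rightarrow> real \<Rightarrow> real \<Rightarrow> quat" where
  "slice_point I x y = of_real x + I * of_real y"

definition slice :: "quat \<Rightarrow> quat set" where
  "slice I = {slice_point I x y |x y. True}"

definition slice_domain :: "quat set \<Rightarrow> bool" where
  "slice_domain \<Omega> \<longleftrightarrow>
     open \<Omega> \<and> connected \<Omega> \<and> \<Omega> \<inter> \<real> \<noteq> {} \<and>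
     (\<forall>I\<in>imag_units. openin (top_of_set (slice I)) (\<Omega> \<inter> slice I) \<and> connected (\<Omega> \<inter> slice I))"

definition slice_symmetric :: "quat set \<Rightarrow> bool" where
  "slice_symmetric \<Omega> \<longleftrightarrow>
     (\<forall>x y. \<forall>I\<in>imag_units. slice_point I x y \<in> \<Omega> \<longrightarrow> (\<forall>J\<in>imag_units. slice_point J x y \<in> \<Omega>))"


section \<open>Slice regular functions\<close>

text \<open>
  The operator \<open>(\<partial>/\<partial>x + I \<partial>/\<partial>y) / 2\<close> applied to \<open>(x, y) \<mapsto> f (x + I y)\<close>; the imaginary unit
  acts on the left.
\<close>

definition dbar :: "quat \<Rightarrow> (quat \<Rightarrow> quat) \<Rightarrow> real \<Rightarrow> real \<Rightarrow> quat" where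
  "dbar I f x y =
     (1 / 2) *\<^sub>R (vector_derivative (\<lambda>s. f (slice_point I s y)) (at x)
       + I * vector_derivative (\<lambda>t. f (slice_point I x t)) (at y))"

text \<open>
  Holomorphy of the restriction to a slice means real (Frechet) differentiability in the two real
  coordinates together with \<open>dbar I f x y = 0\<close>. The mere existence of the partial derivatives would
  not be enough, as \<open>exp (- (1 / q ^ 4))\<close>, extended by 0 at 0, shows. All derivatives are taken at
  points of the open set \<open>\<Omega>\<close>, so the values of \<open>f\<close> outside \<open>\<Omega>\<close> do not matter.
\<close>

definition slice_regular_on :: "quat set \<Rightarrow> (quat \<Rightarrow> quat) \<Rightarrow> bool" where
  "slice_regular_on \<Omega> f \<longleftrightarrow>
     (\<forall>I\<in>imag_units. \<forall>x y. slice_point I x y \<in> \<Omega> \<longrightarrow>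
        (\<lambda>(s, t). f (slice_point I s t)) differentiable (at (x, y)) \<and> dbar I f x y = 0)"


section \<open>Symmetrically analytic functions\<close>

definition sym_poly :: "quat \<Rightarrow> real \<Rightarrow> real \<Rightarrow> nat \<Rightarrow> quat \<Rightarrow> quat" where
  "sym_poly I x0 y0 n q =
     ((q - of_real x0)\<^sup>2 + of_real (y0\<^sup>2)) ^ (n div 2) *
     (if even n then 1 else q - slice_point I x0 y0)"

lemma sym_poly_even:
  "sym_poly I x0 y0 (2 * n) q = ((q - of_real x0)\<^sup>2 + of_real (y0\<^sup>2)) ^ n"
  by (simp add: sym_poly_def)

lemma sym_poly_odd:
  "sym_poly I x0 y0 (2 * n + 1) q =
     ((q - of_real x0)\<^sup>2 + of_real (y0\<^sup>2)) ^ n * (q - slice_point I x0 y0)"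
  by (simp add: sym_poly_def)

text \<open>The expansion has right coefficients, and converges pointwise on a neighbourhood \<open>U\<close>.\<close>

definition symmetrically_analytic_on :: "quat set \<Rightarrow> (quat \<Rightarrow> quat) \<Rightarrow> bool" where
  "symmetrically_analytic_on \<Omega> f \<longleftrightarrow>
     (\<forall>I\<in>imag_units. \<forall>x0 y0. slice_point I x0 y0 \<in> \<Omega> \<longrightarrow>
        (\<exists>A U. open U \<and> slice_point I x0 y0 \<in> U \<and> U \<subseteq> \<Omega> \<and>
           (\<forall>q\<in>U. (\<lambda>n. sym_poly I x0 y0 n q * A n) sums f q)))"

end

theory Submission
  imports Defs "HOL-Complex_Analysis.Complex_Analysis"
begin

text \<open>
  Every slice is a copy of the complex plane: \<open>slice_embed I\<close> sends \<open>x + \<i> y\<close> to \<open>x + I y\<close>.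
  Let \<open>slice_functional I v u\<close> be \<open>\<langle>u, v\<rangle> - \<i> \<langle>I u, v\<rangle>\<close>. This functional on the quaternions is
  complex linear when \<open>\<i>\<close> acts on them as left multiplication by \<open>I\<close>, and its real part is
  \<open>\<langle>u, v\<rangle>\<close>. Hence \<open>f\<close> is regular exactly if all the complex functions obtained by composing these
  functionals with the restrictions of \<open>f\<close> to the slices are complex differentiable
  (\<open>slice_regular_on_iff\<close>), and both implications become statements of complex analysis about the
  polynomial \<open>Q z = (z - x\<^sub>0)\<^sup>2 + y\<^sub>0\<^sup>2\<close>.

  Suppose \<open>f\<close> is symmetrically analytic. On the slice through the centre \<open>q\<^sub>0\<close> all polynomials
  \<open>P\<^sub>n\<close> are complex polynomials, so the functionals turn the expansion into two interleaved power
  series in \<open>Q z\<close>, the second one multiplied by \<open>z - z\<^sub>0\<close>. Convergence at a single point near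
  \<open>z\<^sub>0\<close> where \<open>Q\<close> does not vanish forces both power series to have a positive radius of
  convergence, so the sum is differentiable at \<open>z\<^sub>0\<close>
  (\<open>quadratic_series_field_differentiable\<close>).

  Suppose \<open>f\<close> is regular. For each of the four basis quaternions \<open>e\<close>, averaging
  \<open>slice_functional I e \<circ> f\<close> on one slice with its conjugate at the conjugate point gives a holomorphic function \<open>F e\<close> that
  commutes with conjugation and whose values at real points are the coordinates of \<open>f\<close> along \<open>e\<close>.
  On each slice, \<open>f\<close> and \<open>\<Sum>e. F e \<cdot> e\<close> agree at the real points, hence everywhere by the identity
  theorem (\<open>slice_regular_real_components\<close>). A holomorphic \<open>F\<close> commuting with conjugation has the
  form \<open>F z = d (Q z) + (z - x\<^sub>0) c (Q z)\<close> near \<open>z\<^sub>0\<close> and its conjugate, where \<open>d\<close> and \<open>c\<close> are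
  power series with real coefficients (\<open>intrinsic_quadratic_expansion\<close>). Real coefficients are
  central in the quaternions, so this identity holds on every slice with the same coefficients,
  and writing \<open>q - x\<^sub>0 = (q - q\<^sub>0) + (q\<^sub>0 - x\<^sub>0)\<close> turns it into the required expansion.
\<close>

section \<open>Slices as copies of the complex plane\<close>

definition slice_embed :: "quat \<Rightarrow> complex \<Rightarrow> quat" where
  "slice_embed I z = slice_point I (Re z) (Im z)"

text \<open>
  The minus sign and the position of \<open>I\<close> are dictated by the rule
  \<open>slice_functional I v (I * u) = \<i> * slice_functional I v u\<close>.
\<close>

definition slice_functional :: "quat \<Rightarrow> quat \<Rightarrow> quat \<Rightarrow> complex" where
  "slice_functional I v u = Complex (inner u v) (- inner (I * u) v)"

lemma of_real_quat_components [simp]: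
  "qRe (of_real r) = r" "qIm1 (of_real r) = 0" "qIm2 (of_real r) = 0" "qIm3 (of_real r) = 0"
  by (simp_all add: of_real_def)

lemma imag_units_iff:
  "q \<in> imag_units \<longleftrightarrow> qRe q = 0 \<and> (qIm1 q)\<^sup>2 + (qIm2 q)\<^sup>2 + (qIm3 q)\<^sup>2 = 1"
proof
  assume "q \<in> imag_units"
  then have sq: "q * q = -1"
    by (simp add: imag_units_def power2_eq_square)
  then have "norm q * norm q = 1"
    by (metis norm_minus_cancel norm_mult norm_one)
  then have n: "(qRe q)\<^sup>2 + (qIm1 q)\<^sup>2 + (qIm2 q)\<^sup>2 + (qIm3 q)\<^sup>2 = 1"
    by (simp add: norm_quat_def inner_quat_def power2_eq_square)
  from sq have "qRe (q * q) = qRe (-1)"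
    by simp
  then have "(qRe q)\<^sup>2 - (qIm1 q)\<^sup>2 - (qIm2 q)\<^sup>2 - (qIm3 q)\<^sup>2 = -1"
    by (simp add: power2_eq_square)
  with n have "(qRe q)\<^sup>2 = 0"
    by linarith
  with n show "qRe q = 0 \<and> (qIm1 q)\<^sup>2 + (qIm2 q)\<^sup>2 + (qIm3 q)\<^sup>2 = 1"
    by simp
next
  assume "qRe q = 0 \<and> (qIm1 q)\<^sup>2 + (qIm2 q)\<^sup>2 + (qIm3 q)\<^sup>2 = 1"
  then show "q \<in> imag_units"
    by (simp add: imag_units_def power2_eq_square quat_eq_iff)
qed

lemma imag_unit_square: "I \<in> imag_units \<Longrightarrow> I * (I * q) = - q"
  unfolding mult.assoc[symmetric] by (simp add: imag_units_def power2_eq_square)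

lemma uminus_imag_unit: "I \<in> imag_units \<Longrightarrow> - I \<in> imag_units"
  by (simp add: imag_units_iff)

lemma imag_units_nonempty: "Quat 0 1 0 0 \<in> imag_units"
  by (simp add: imag_units_iff)

lemma slice_embed_eq: "slice_embed I z = Re z *\<^sub>R 1 + Im z *\<^sub>R I"
  by (simp add: slice_embed_def slice_point_def of_real_def)

lemma slice_embed_real [simp]: "slice_embed I (of_real r) = of_real r"
  by (simp add: slice_embed_def slice_point_def)

lemma slice_embed_cnj: "slice_embed I (cnj z) = slice_embed (- I) z"
  by (simp add: slice_embed_def slice_point_def)

lemma slice_embed_add: "slice_embed I (z + w) = slice_embed I z + slice_embed I w"
  by (simp add: slice_embed_def slice_point_def algebra_simps)

lemma slice_embed_scaleR: "slice_embed I (r *\<^sub>R z) = r *\<^sub>R slice_embed I z"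
  by (simp add: slice_embed_def slice_point_def quat_eq_iff algebra_simps)

lemma bounded_linear_slice_embed: "bounded_linear (slice_embed I)"
  unfolding linear_conv_bounded_linear[symmetric]
  by (intro linearI) (rule slice_embed_add slice_embed_scaleR)+

lemmas slice_embed_diff = bounded_linear.linear[OF bounded_linear_slice_embed, THEN linear_diff]

lemma slice_embed_mult:
  assumes "I \<in> imag_units"
  shows "slice_embed I (z * w) = slice_embed I z * slice_embed I w"
proof -
  have "I * I = -1"
    using assms by (simp add: imag_units_def power2_eq_square)
  then show ?thesis
    by (simp add: slice_embed_eq algebra_simps)
qed

lemma slice_embed_power:
  assumes "I \<in> imag_units"
  shows "slice_embed I (z ^ n) = slice_embed I z ^ n"
proof (induction n)
  case 0
  show ?case using slice_embed_real[of I 1] by simp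
qed (simp add: slice_embed_mult[OF assms])

lemma norm_slice_embed:
  assumes "I \<in> imag_units"
  shows "norm (slice_embed I z) = norm z"
proof -
  have *: "qRe I = 0" "(qIm1 I)\<^sup>2 + (qIm2 I)\<^sup>2 + (qIm3 I)\<^sup>2 = 1"
    using assms by (auto simp: imag_units_iff)
  have "inner (slice_embed I z) (slice_embed I z) =
     (Re z)\<^sup>2 + ((qIm1 I)\<^sup>2 + (qIm2 I)\<^sup>2 + (qIm3 I)\<^sup>2) * (Im z)\<^sup>2"
    by (simp add: slice_embed_def slice_point_def inner_quat_def *(1) algebra_simps power2_eq_square)
  then show ?thesis
    by (simp add: norm_quat_def cmod_def *(2))
qed

lemma quat_in_some_slice:
  obtains J z where "J \<in> imag_units" "slice_embed J z = q"
proof -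
  define r where "r = sqrt ((qIm1 q)\<^sup>2 + (qIm2 q)\<^sup>2 + (qIm3 q)\<^sup>2)"
  have r2: "r\<^sup>2 = (qIm1 q)\<^sup>2 + (qIm2 q)\<^sup>2 + (qIm3 q)\<^sup>2"
    by (simp add: r_def)
  show ?thesis
  proof (cases "r = 0")
    case True
    then have "slice_embed (Quat 0 1 0 0) (Complex (qRe q) 0) = q"
      using r2 by (auto simp: slice_embed_def slice_point_def quat_eq_iff add_nonneg_eq_0_iff)
    then show ?thesis
      using that imag_units_nonempty by blast
  next
    case False
    define J where "J = Quat 0 (qIm1 q / r) (qIm2 q / r) (qIm3 q / r)"
    have "J \<in> imag_units"
      using False r2 by (simp add: imag_units_iff J_def power_divide add_divide_distrib[symmetric] r2[symmetric])
    moreover have "slice_embed J (Complex (qRe q) r) = q"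
      using False by (simp add: slice_embed_def slice_point_def quat_eq_iff J_def)
    ultimately show ?thesis
      using that by blast
  qed
qed

lemma slice_point_eq_embed: "slice_point I x y = slice_embed I (Complex x y)"
  by (simp add: slice_embed_def)

lemma slice_eq_range: "slice I = range (slice_embed I)"
proof
  show "slice I \<subseteq> range (slice_embed I)"
    by (auto simp: slice_def slice_point_eq_embed)
  show "range (slice_embed I) \<subseteq> slice I"
    by (auto simp: slice_def slice_embed_def)
qed

lemma bounded_linear_slice_functional: "bounded_linear (slice_functional I v)"
  unfolding linear_conv_bounded_linear[symmetric]
  by (intro linearI)
    (simp_all add: slice_functional_def complex_eq_iff algebra_simps inner_add_left)

lemma slice_functional_embed_mult:
  assumes "I \<in> imag_units"
  shows "slice_functional I v (slice_embed I z * u) = z * slice_functional I v u"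
proof -
  have *: "slice_embed I z * u = Re z *\<^sub>R u + Im z *\<^sub>R (I * u)" for u
    by (simp add: slice_embed_def slice_point_def of_real_def algebra_simps)
  have **: "I * (slice_embed I z * u) = Re z *\<^sub>R (I * u) + Im z *\<^sub>R (- u)"
    using imag_unit_square[OF assms, of u]
    by (simp add: * algebra_simps mult_scaleR_right)
  show ?thesis
    unfolding slice_functional_def **
    by (simp add: * complex_eq_iff inner_add_left inner_diff_left)
qed

text \<open>
  The real part of \<open>slice_functional I v\<close> is the coordinate along \<open>v\<close>, so these functionals separate
  points.
\<close>

lemma slice_functional_eqI:
  assumes "\<And>v. v \<in> Basis \<Longrightarrow> slice_functional I v a = slice_functional I v b"
  shows "a = b"
proof (rule euclidean_eqI)
  fix v :: quat assume "v \<in> Basis"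
  then have "Re (slice_functional I v a) = Re (slice_functional I v b)"
    by (simp only: assms)
  then show "inner a v = inner b v"
    by (simp add: slice_functional_def)
qed

section \<open>Holomorphy on a slice\<close>

text \<open>
  The Cauchy-Riemann equation says that the derivative \<open>L\<close> satisfies \<open>L (0, 1) = I * L (1, 0)\<close>,
  that is, \<open>L h\<close> is \<open>h\<close>, placed in the slice, times the fixed quaternion \<open>L (1, 0)\<close>.
\<close>

lemma dbar_zero_iff_has_derivative:
  assumes "I \<in> imag_units"
  shows "(\<lambda>(s, t). f (slice_point I s t)) differentiable (at (x, y)) \<and> dbar I f x y = 0 \<longleftrightarrow>
    (\<exists>a. ((\<lambda>z. f (slice_embed I z)) has_derivative (\<lambda>h. slice_embed I h * a)) (at (Complex x y)))"
    (is "?L \<longleftrightarrow> ?R")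
proof -
  define g where "g = (\<lambda>(s, t). f (slice_point I s t))"
  define u where "u = (\<lambda>z. f (slice_embed I z))"
  have gu: "g = u \<circ> (\<lambda>p. Complex (fst p) (snd p))" and ug: "u = g \<circ> (\<lambda>z. (Re z, Im z))"
    by (auto simp: g_def u_def slice_embed_def)
  have C: "((\<lambda>p. Complex (fst p) (snd p)) has_derivative (\<lambda>p. Complex (fst p) (snd p))) (at p)" for p
    unfolding Complex_eq by (auto intro!: derivative_eq_intros)
  have P: "((\<lambda>z. (Re z, Im z)) has_derivative (\<lambda>z. (Re z, Im z))) (at z)" for z
    by (auto intro!: derivative_eq_intros)
  have dbar: "2 *\<^sub>R dbar I f x y = L (1, 0) + I * L (0, 1)"
    if L: "(g has_derivative L) (at (x, y))" for L
  proof -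
    interpret L: bounded_linear L using L by (rule has_derivative_bounded_linear)
    have "((\<lambda>s. g (s, y)) has_derivative (\<lambda>h. L (h, 0))) (at x)"
      by (rule has_derivative_compose[where f = "\<lambda>s. (s, y)"]) (rule has_derivative_Pair derivative_intros L)+
    moreover have "(\<lambda>h. L (h, 0)) = (\<lambda>h. h *\<^sub>R L (1, 0))"
      by (simp flip: L.scaleR)
    ultimately have 1: "((\<lambda>s. g (s, y)) has_vector_derivative L (1, 0)) (at x)"
      by (simp only: has_vector_derivative_def)
    have "((\<lambda>t. g (x, t)) has_derivative (\<lambda>h. L (0, h))) (at y)"
      by (rule has_derivative_compose[where f = "\<lambda>t. (x, t)"]) (rule has_derivative_Pair derivative_intros L)+
    moreover have "(\<lambda>h. L (0, h)) = (\<lambda>h. h *\<^sub>R L (0, 1))"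
      by (simp flip: L.scaleR)
    ultimately have 2: "((\<lambda>t. g (x, t)) has_vector_derivative L (0, 1)) (at y)"
      by (simp only: has_vector_derivative_def)
    show ?thesis
      using vector_derivative_at[OF 1] vector_derivative_at[OF 2] by (simp add: dbar_def g_def)
  qed
  show ?thesis
  proof
    assume ?L
    then obtain L where L: "(g has_derivative L) (at (x, y))"
      by (auto simp: g_def differentiable_def)
    interpret L: bounded_linear L using L by (rule has_derivative_bounded_linear)
    from \<open>?L\<close> dbar[OF L] have "L (1, 0) + I * L (0, 1) = 0"
      by simp
    \<comment> \<open>multiplying by \<open>I\<close> solves this equation for \<open>L (0, 1)\<close>\<close>
    then have "I * (L (1, 0) + I * L (0, 1)) = 0"
      by simp
    then have L01: "L (0, 1) = I * L (1, 0)"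
      by (simp add: distrib_left imag_unit_square[OF assms])
    have "(u has_derivative (\<lambda>h. L (Re h, Im h))) (at (Complex x y))"
      unfolding ug o_def by (rule has_derivative_compose[OF P]) (simp add: L)
    moreover have "L (Re h, Im h) = slice_embed I h * L (1, 0)" for h
    proof -
      have "L (Re h, Im h) = L (Re h *\<^sub>R (1, 0) + Im h *\<^sub>R (0, 1))"
        by simp
      also have "\<dots> = Re h *\<^sub>R L (1, 0) + Im h *\<^sub>R L (0, 1)"
        by (simp only: L.add L.scaleR)
      finally show ?thesis
        by (simp add: L01 slice_embed_def slice_point_def of_real_def algebra_simps)
    qed
    ultimately show ?R
      by (auto simp: u_def)
  next
    assume ?R
    then obtain a where a: "(u has_derivative (\<lambda>h. slice_embed I h * a)) (at (Complex x y))"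
      by (auto simp: u_def)
    have g: "(g has_derivative (\<lambda>p. slice_embed I (Complex (fst p) (snd p)) * a)) (at (x, y))"
      unfolding gu o_def by (rule has_derivative_compose[OF C]) (simp add: a)
    have "2 *\<^sub>R dbar I f x y = 0"
      using imag_unit_square[OF assms, of a]
      by (simp add: dbar[OF g] slice_embed_def slice_point_def)
    with g show ?L
      by (auto simp: g_def differentiable_def)
  qed
qed

text \<open>
  The functionals carry slice-linear derivatives to complex derivatives. Conversely, if all of them
  give complex differentiable functions, the real parts of the derivatives assemble into a real
  derivative of \<open>u\<close>, which must be slice-linear because the functionals separate points.
\<close>

lemma has_derivative_slice_iff:
  assumes I: "I \<in> imag_units"
  shows "(\<exists>a. (u has_derivative (\<lambda>h. slice_embed I h * a)) (at z)) \<longleftrightarrow>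
    (\<forall>v. (\<lambda>w. slice_functional I v (u w)) field_differentiable at z)"
proof safe
  fix a v assume "(u has_derivative (\<lambda>h. slice_embed I h * a)) (at z)"
  then have "((\<lambda>w. slice_functional I v (u w)) has_derivative
      (\<lambda>h. slice_functional I v (slice_embed I h * a))) (at z)"
    by (rule bounded_linear.has_derivative[OF bounded_linear_slice_functional])
  then show "(\<lambda>w. slice_functional I v (u w)) field_differentiable at z"
    unfolding slice_functional_embed_mult[OF I] field_differentiable_def has_field_derivative_def
    by (subst (asm) mult.commute) blast
next
  assume "\<forall>v. (\<lambda>w. slice_functional I v (u w)) field_differentiable at z"
  then obtain d where d: "\<And>v. ((\<lambda>w. slice_functional I v (u w)) has_derivative (*) (d v)) (at z)"
    unfolding field_differentiable_def has_field_derivative_def by metis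
  define L where "L h = (\<Sum>v\<in>Basis. Re (d v * h) *\<^sub>R v)" for h
  have comp: "((\<lambda>w. inner (u w) v) has_derivative (\<lambda>h. inner (L h) v)) (at z)" if "v \<in> Basis" for v
  proof -
    have "((\<lambda>w. Re (slice_functional I v (u w))) has_derivative (\<lambda>h. Re (d v * h))) (at z)"
      by (rule bounded_linear.has_derivative[OF bounded_linear_Re d])
    moreover have "inner (L h) v = Re (d v * h)" for h
      unfolding L_def using that by (rule inner_sum_left_Basis)
    moreover have "Re (slice_functional I v q) = inner q v" for q
      by (simp add: slice_functional_def)
    ultimately show ?thesis
      by (simp only:)
  qed
  have L: "(u has_derivative L) (at z)"
    by (rule has_derivative_componentwise_within[THEN iffD2, OF ballI]) (rule comp)
  have Lv: "slice_functional I v (L h) = d v * h" for v h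
  proof -
    have "((\<lambda>w. slice_functional I v (u w)) has_derivative (\<lambda>h. slice_functional I v (L h))) (at z)"
      by (rule bounded_linear.has_derivative[OF bounded_linear_slice_functional L])
    from has_derivative_unique[OF this d] show ?thesis
      by (rule fun_cong)
  qed
  define a where "a = L 1"
  have "L h = slice_embed I h * a" for h
    by (rule slice_functional_eqI[of I])
      (simp add: a_def slice_functional_embed_mult[OF I] Lv mult.commute)
  then have "L = (\<lambda>h. slice_embed I h * a)" ..
  with L show "\<exists>a. (u has_derivative (\<lambda>h. slice_embed I h * a)) (at z)"
    by blast
qed

lemma slice_regular_on_iff:
  "slice_regular_on \<Omega> f \<longleftrightarrow>
    (\<forall>I\<in>imag_units. \<forall>z v. slice_embed I z \<in> \<Omega> \<longrightarrow>
      (\<lambda>w. slice_functional I v (f (slice_embed I w))) field_differentiable at z)"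
proof -
  have *: "(\<lambda>(s, t). f (slice_point I s t)) differentiable (at (x, y)) \<and> dbar I f x y = 0 \<longleftrightarrow>
     (\<forall>v. (\<lambda>w. slice_functional I v (f (slice_embed I w))) field_differentiable at (Complex x y))"
    if "I \<in> imag_units" for I x y
    by (rule trans[OF dbar_zero_iff_has_derivative[OF that] has_derivative_slice_iff[OF that]])
  show ?thesis
  proof safe
    fix I z v assume "slice_regular_on \<Omega> f" "I \<in> imag_units" "slice_embed I z \<in> \<Omega>"
    then show "(\<lambda>w. slice_functional I v (f (slice_embed I w))) field_differentiable at z"
      using *[of I "Re z" "Im z"] unfolding slice_regular_on_def slice_embed_def complex.collapse
      by blast
  next
    assume R: "\<forall>I\<in>imag_units. \<forall>z v. slice_embed I z \<in> \<Omega> \<longrightarrow>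
      (\<lambda>w. slice_functional I v (f (slice_embed I w))) field_differentiable at z"
    have "(\<lambda>(s, t). f (slice_point I s t)) differentiable (at (x, y)) \<and> dbar I f x y = 0"
      if "I \<in> imag_units" "slice_point I x y \<in> \<Omega>" for I x y
    proof -
      have "slice_embed I (Complex x y) \<in> \<Omega>"
        using that(2) by (simp add: slice_embed_def)
      with R that(1) show ?thesis
        unfolding *[OF that(1)] by blast
    qed
    then show "slice_regular_on \<Omega> f"
      unfolding slice_regular_on_def by blast
  qed
qed

section \<open>Power series and expansions in a quadratic polynomial\<close>

lemma sums_even_iff:
  fixes f :: "nat \<Rightarrow> 'a::real_normed_vector"
  assumes "\<And>n. odd n \<Longrightarrow> f n = 0"
  shows "(\<lambda>n. f (2 * n)) sums a \<longleftrightarrow> f sums a"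
  by (rule sums_mono_reindex) (auto simp: strict_mono_def intro!: assms)

lemma sums_odd_iff:
  fixes f :: "nat \<Rightarrow> 'a::real_normed_vector"
  assumes "\<And>n. even n \<Longrightarrow> f n = 0"
  shows "(\<lambda>n. f (2 * n + 1)) sums a \<longleftrightarrow> f sums a"
proof (rule sums_mono_reindex)
  show "f n = 0" if "n \<notin> range (\<lambda>n. 2 * n + 1)" for n
    using that by (intro assms) (metis oddE rangeI)
qed (auto simp: strict_mono_def)

lemma sums_interleave:
  fixes f g :: "nat \<Rightarrow> 'a::real_normed_vector"
  assumes "f sums a" "g sums b"
  shows "(\<lambda>n. if even n then f (n div 2) else g (n div 2)) sums (a + b)"
proof -
  have "(\<lambda>n. if even n then f (n div 2) else 0) sums a"
    using sums_even_iff[of "\<lambda>n. if even n then f (n div 2) else 0" a] assms(1) by simp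
  moreover have "(\<lambda>n. if odd n then g (n div 2) else 0) sums b"
    using sums_odd_iff[of "\<lambda>n. if odd n then g (n div 2) else 0" b] assms(2) by simp
  ultimately have "(\<lambda>n. (if even n then f (n div 2) else 0) + (if odd n then g (n div 2) else 0)) sums (a + b)"
    by (rule sums_add)
  then show ?thesis
    by (rule sums_cong[THEN iffD1, rotated]) auto
qed

text \<open>
  Conjugating the Taylor series of \<open>H\<close> at \<open>cnj w\<close> gives a second expansion of \<open>H w\<close>, with conjugate
  coefficients; the average of the two has the real parts as coefficients.
\<close>

lemma real_power_series:
  assumes "H holomorphic_on ball 0 r" and cnj: "\<And>w. w \<in> ball 0 r \<Longrightarrow> H (cnj w) = cnj (H w)"
  obtains d :: "nat \<Rightarrow> real" where "\<And>w. w \<in> ball 0 r \<Longrightarrow> (\<lambda>n. of_real (d n) * w ^ n) sums H w"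
proof
  define a where "a n = (deriv ^^ n) H 0 / fact n" for n
  have a: "(\<lambda>n. a n * w ^ n) sums H w" if "w \<in> ball 0 r" for w
    using holomorphic_power_series[OF assms(1) that] by (simp add: a_def)
  fix w :: complex assume w: "w \<in> ball 0 r"
  then have "cnj w \<in> ball 0 r"
    by simp
  from a[OF this] have "(\<lambda>n. a n * cnj w ^ n) sums cnj (H w)"
    by (simp only: cnj[OF w])
  then have "(\<lambda>n. cnj (a n) * w ^ n) sums H w"
    by (subst (asm) sums_cnj[symmetric]) simp
  from sums_divide[OF sums_add[OF a[OF w] this], of 2]
  have "(\<lambda>n. (a n + cnj (a n)) / 2 * w ^ n) sums H w"
    by (simp add: algebra_simps add_divide_distrib)
  then show "(\<lambda>n. of_real (Re (a n)) * w ^ n) sums H w"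
    by (simp add: complex_add_cnj)
qed

lemma even_odd_power_series:
  fixes a :: "nat \<Rightarrow> 'a::real_normed_field"
  assumes p: "(\<lambda>n. a n * t ^ n) sums p" and m: "(\<lambda>n. a n * (- t) ^ n) sums m"
  shows "(\<lambda>n. a (2 * n) * (t\<^sup>2) ^ n) sums ((p + m) / 2)"
    and "(\<lambda>n. a (2 * n + 1) * (t\<^sup>2) ^ n * t) sums ((p - m) / 2)"
proof -
  have "(\<lambda>n. if even n then a n * t ^ n else 0) sums ((p + m) / 2)"
    using sums_divide[OF sums_add[OF p m], of 2]
    by (rule sums_cong[THEN iffD1, rotated]) auto
  then show "(\<lambda>n. a (2 * n) * (t\<^sup>2) ^ n) sums ((p + m) / 2)"
    using sums_even_iff[of "\<lambda>n. if even n then a n * t ^ n else 0" "(p + m) / 2"]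
    by (simp add: power_mult)
  have "(\<lambda>n. if odd n then a n * t ^ n else 0) sums ((p - m) / 2)"
    using sums_divide[OF sums_diff[OF p m], of 2]
    by (rule sums_cong[THEN iffD1, rotated]) auto
  then have "(\<lambda>n. a (2 * n + 1) * t ^ (2 * n + 1)) sums ((p - m) / 2)"
    using sums_odd_iff[of "\<lambda>n. if odd n then a n * t ^ n else 0" "(p - m) / 2"] by simp
  then show "(\<lambda>n. a (2 * n + 1) * (t\<^sup>2) ^ n * t) sums ((p - m) / 2)"
    by (simp only: power_add power_one_right power_mult mult.assoc)
qed

text \<open>
  Given \<open>w = Q z\<close>, the point \<open>z\<close> is one of the two roots \<open>x\<^sub>0 + a\<close> and \<open>x\<^sub>0 - a\<close> of \<open>Q z = w\<close>, where
  \<open>a\<^sup>2 = w - y\<^sub>0\<^sup>2\<close>. Hence \<open>F z = d w + (z - x\<^sub>0) c w\<close> for \<open>d = (F (x\<^sub>0 + a) + F (x\<^sub>0 - a)) / 2\<close> and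
  \<open>c = (F (x\<^sub>0 + a) - F (x\<^sub>0 - a)) / (2 a)\<close>, at both roots. If \<open>y\<^sub>0 = 0\<close>, these are the even part and,
  divided by \<open>a\<close>, the odd part of the Taylor series at \<open>x\<^sub>0\<close>, read as power series in \<open>w = a\<^sup>2\<close>. Otherwise \<open>a\<close> can be
  chosen holomorphic in \<open>w\<close> near 0, and then \<open>d\<close> and \<open>c\<close> are holomorphic. They commute with
  conjugation because conjugation permutes the two roots, so their coefficients are real.
\<close>

lemma intrinsic_quadratic_expansion:
  fixes x0 y0 :: real
  assumes D: "open D" and F: "F holomorphic_on D"
    and cnj_D: "\<And>z. z \<in> D \<Longrightarrow> cnj z \<in> D" and cnj_F: "\<And>z. z \<in> D \<Longrightarrow> F (cnj z) = cnj (F z)"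
    and z0: "Complex x0 y0 \<in> D"
  defines "Q \<equiv> \<lambda>z. (z - of_real x0)\<^sup>2 + of_real (y0\<^sup>2)"
  obtains r and d c :: "nat \<Rightarrow> real" where "r > 0"
    and "\<And>z. norm (Q z) < r \<Longrightarrow> z \<in> D"
    and "\<And>z. norm (Q z) < r \<Longrightarrow> \<exists>s t. (\<lambda>n. of_real (d n) * Q z ^ n) sums s \<and>
            (\<lambda>n. of_real (c n) * Q z ^ n) sums t \<and> F z = s + (z - of_real x0) * t"
proof (cases "y0 = 0")
  case True
  have "complex_of_real x0 \<in> D"
    using z0 True by (simp add: complex_of_real_def)
  then obtain e where e: "e > 0" "ball (of_real x0) e \<subseteq> D"
    using D open_contains_ball by blast
  have in_D: "of_real x0 + t \<in> D" if "norm t < e" for t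
    using that by (intro subsetD[OF e(2)]) (simp add: dist_norm)
  define H where "H t = F (of_real x0 + t)" for t
  have "H holomorphic_on ball 0 e"
    unfolding H_def by (rule holomorphic_on_compose_gen[unfolded o_def, OF _ F])
      (use e(2) in \<open>auto intro!: holomorphic_intros\<close>)
  moreover have "H (cnj t) = cnj (H t)" if "t \<in> ball 0 e" for t
    using cnj_F[of "of_real x0 + t"] in_D[of t] that by (simp add: H_def)
  ultimately obtain a :: "nat \<Rightarrow> real"
    where a: "\<And>t. t \<in> ball 0 e \<Longrightarrow> (\<lambda>n. of_real (a n) * t ^ n) sums H t"
    using real_power_series by blast
  show ?thesis
  proof (rule that)
    show "e\<^sup>2 > 0"
      using e(1) by simp
    fix z assume "norm (Q z) < e\<^sup>2"
    define t where "t = z - of_real x0"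
    have Qt: "Q z = t\<^sup>2"
      by (simp add: Q_def t_def True)
    with \<open>norm (Q z) < e\<^sup>2\<close> have t: "norm t < e"
      using e(1) by (simp add: norm_power power2_less_imp_less)
    have z: "z = of_real x0 + t"
      by (simp add: t_def)
    show "z \<in> D"
      unfolding z using t by (rule in_D)
    note * = even_odd_power_series[of "\<lambda>n. of_real (a n)" t "H t" "H (- t)"]
    have ev: "(\<lambda>n. of_real (a (2 * n)) * Q z ^ n) sums ((H t + H (- t)) / 2)"
      unfolding Qt using t by (intro * a) auto
    have "\<exists>s. (\<lambda>n. of_real (a (2 * n + 1)) * Q z ^ n) sums s \<and> t * s = (H t - H (- t)) / 2"
    proof (cases "t = 0")
      case True
      then show ?thesis
        using powser_sums_zero[of "\<lambda>n. complex_of_real (a (2 * n + 1))"] by (auto simp: Qt)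
    next
      case False
      have "(\<lambda>n. of_real (a (2 * n + 1)) * (t\<^sup>2) ^ n * t) sums ((H t - H (- t)) / 2)"
        using t by (intro * a) auto
      from sums_divide[OF this, of t] False show ?thesis
        by (intro exI[of _ "(H t - H (- t)) / 2 / t"]) (simp add: Qt)
    qed
    then obtain s where od: "(\<lambda>n. of_real (a (2 * n + 1)) * Q z ^ n) sums s" and s: "t * s = (H t - H (- t)) / 2"
      by blast
    have "F z = (H t + H (- t)) / 2 + (H t - H (- t)) / 2"
      by (simp add: H_def z field_simps)
    then have "F z = (H t + H (- t)) / 2 + (z - of_real x0) * s"
      by (simp only: s[symmetric] t_def[symmetric])
    with ev od show "\<exists>s s'. (\<lambda>n. of_real (a (2 * n)) * Q z ^ n) sums s \<and>
            (\<lambda>n. of_real (a (2 * n + 1)) * Q z ^ n) sums s' \<and> F z = s + (z - of_real x0) * s'"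
      by blast
  qed
next
  case False
  \<comment> \<open>With this principal square root, \<open>\<i> * s w\<close> is the \<open>a\<close> above; \<open>\<bar>w\<bar> < y0\<^sup>2\<close> keeps its argument off the branch cut.\<close>
  define s where "s w = csqrt (of_real (y0\<^sup>2) - w)" for w
  define R where "R = y0\<^sup>2"
  have R: "R > 0"
    using False by (simp add: R_def)
  have Re_pos: "Re (of_real (y0\<^sup>2) - w) > 0" if "norm w < R" for w
    using that complex_Re_le_cmod[of w] by (simp add: R_def)
  have s_holo: "s holomorphic_on ball 0 R"
    unfolding s_def using Re_pos by (force intro!: holomorphic_intros simp: complex_nonpos_Reals_iff)
  have s_cnj: "s (cnj w) = cnj (s w)" if "norm w < R" for w
  proof -
    have "of_real (y0\<^sup>2) - w \<notin> \<real>\<^sub>\<le>\<^sub>0"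
      using Re_pos[OF that] by (force simp: complex_nonpos_Reals_iff)
    from cnj_csqrt[OF this] show ?thesis
      by (simp add: s_def)
  qed
  have s_nz: "s w \<noteq> 0" if "norm w < R" for w
    using Re_pos[OF that] by (auto simp: s_def)
  have s0: "s 0 = of_real \<bar>y0\<bar>"
    by (simp add: s_def csqrt_of_real_nonneg)
  have "of_real x0 + \<i> * s 0 \<in> D"
  proof (cases "y0 \<ge> 0")
    case True
    then show ?thesis using z0 by (simp add: s0 Complex_eq)
  next
    case False
    then show ?thesis using cnj_D[OF z0] by (simp add: s0 Complex_eq)
  qed
  moreover have "isCont (\<lambda>w. of_real x0 + \<i> * s w) 0"
    using holomorphic_on_imp_continuous_on[OF s_holo] R
    by (intro continuous_intros) (auto simp: continuous_on_eq_continuous_at)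
  ultimately have "\<forall>\<^sub>F w in at 0. of_real x0 + \<i> * s w \<in> D"
    using D topological_tendstoD unfolding isCont_def by blast
  then obtain r' where r': "r' > 0" "\<And>w. w \<noteq> 0 \<Longrightarrow> norm w < r' \<Longrightarrow> of_real x0 + \<i> * s w \<in> D"
    unfolding eventually_at by auto
  define r where "r = min r' R"
  have r: "r > 0" "r \<le> R"
    using r'(1) R by (auto simp: r_def)
  have up: "of_real x0 + \<i> * s w \<in> D" if "norm w < r" for w
    using r'(2)[of w] \<open>of_real x0 + \<i> * s 0 \<in> D\<close> that by (cases "w = 0") (auto simp: r_def)
  have down_eq: "of_real x0 - \<i> * s w = cnj (of_real x0 + \<i> * s (cnj w))" if "norm w < r" for w
    using s_cnj[of w] that r by simp
  have down: "of_real x0 - \<i> * s w \<in> D" if "norm w < r" for w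
    unfolding down_eq[OF that] using that by (intro cnj_D up) simp
  \<comment> \<open>the values of \<open>F\<close> at the two roots; conjugation exchanges them\<close>
  define p where "p w = F (of_real x0 + \<i> * s w)" for w
  define m where "m w = F (of_real x0 - \<i> * s w)" for w
  have s_holo': "s holomorphic_on ball 0 r"
    using s_holo by (rule holomorphic_on_subset) (use r in auto)
  have p_holo: "p holomorphic_on ball 0 r"
    unfolding p_def by (rule holomorphic_on_compose_gen[unfolded o_def, OF _ F])
      (auto intro!: holomorphic_intros up s_holo')
  have m_holo: "m holomorphic_on ball 0 r"
    unfolding m_def by (rule holomorphic_on_compose_gen[unfolded o_def, OF _ F])
      (auto intro!: holomorphic_intros down s_holo')
  have m_eq: "m w = cnj (p (cnj w))" if "norm w < r" for w
    unfolding m_def p_def down_eq[OF that] using that by (intro cnj_F up) simp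
  have p_cnj: "p (cnj w) = cnj (m w)" if "norm w < r" for w
    using m_eq[OF that] by simp
  have m_cnj: "m (cnj w) = cnj (p w)" if "norm w < r" for w
    using m_eq[of "cnj w"] that by simp
  have "(\<lambda>w. (p w + m w) / 2) holomorphic_on ball 0 r"
    by (intro holomorphic_intros p_holo m_holo) simp
  moreover have "(p (cnj w) + m (cnj w)) / 2 = cnj ((p w + m w) / 2)" if "w \<in> ball 0 r" for w
    using that by (simp add: p_cnj m_cnj)
  ultimately obtain d :: "nat \<Rightarrow> real"
    where d: "\<And>w. w \<in> ball 0 r \<Longrightarrow> (\<lambda>n. of_real (d n) * w ^ n) sums ((p w + m w) / 2)"
    by (rule real_power_series[of "\<lambda>w. (p w + m w) / 2"]) blast+
  have "(\<lambda>w. (p w - m w) / (2 * (\<i> * s w))) holomorphic_on ball 0 r"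
    using s_nz r by (intro holomorphic_intros p_holo m_holo s_holo') auto
  moreover have "(p (cnj w) - m (cnj w)) / (2 * (\<i> * s (cnj w))) = cnj ((p w - m w) / (2 * (\<i> * s w)))"
    if "w \<in> ball 0 r" for w
    using that r s_nz[of w] by (simp add: p_cnj m_cnj s_cnj field_simps)
  ultimately obtain c :: "nat \<Rightarrow> real"
    where c: "\<And>w. w \<in> ball 0 r \<Longrightarrow> (\<lambda>n. of_real (c n) * w ^ n) sums ((p w - m w) / (2 * (\<i> * s w)))"
    by (rule real_power_series[of "\<lambda>w. (p w - m w) / (2 * (\<i> * s w))"]) blast+
  have root: "z - of_real x0 = \<i> * s (Q z) \<or> z - of_real x0 = - (\<i> * s (Q z))" for z
    unfolding power2_eq_iff[symmetric] by (simp add: s_def Q_def power_mult_distrib)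
  show ?thesis
  proof (rule that)
    show "r > 0" by fact
    fix z assume Qz: "norm (Q z) < r"
    consider "z = of_real x0 + \<i> * s (Q z)" | "z = of_real x0 - \<i> * s (Q z)"
      using root[of z] by (auto simp: algebra_simps)
    note z_cases = this
    show "z \<in> D"
      by (rule z_cases) (metis up down Qz)+
    have nz: "s (Q z) \<noteq> 0"
      using s_nz[of "Q z"] Qz r by simp
    have solve_up: "u = (u + v) / 2 + a * ((u - v) / (2 * a))"
      and solve_down: "v = (u + v) / 2 + (- a) * ((u - v) / (2 * a))" if "a \<noteq> 0" for u v a :: complex
      using that by (simp_all add: field_simps)
    from z_cases have "F z = (p (Q z) + m (Q z)) / 2 +
        (z - of_real x0) * ((p (Q z) - m (Q z)) / (2 * (\<i> * s (Q z))))"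
    proof cases
      case 1
      have "z - of_real x0 = \<i> * s (Q z)"
        using arg_cong[OF 1, of "\<lambda>u. u - of_real x0"] by simp
      moreover have "F z = p (Q z)"
        unfolding p_def by (rule arg_cong[OF 1])
      ultimately show ?thesis using solve_up[of "\<i> * s (Q z)"] nz by simp
    next
      case 2
      have "z - of_real x0 = - (\<i> * s (Q z))"
        using arg_cong[OF 2, of "\<lambda>u. u - of_real x0"] by simp
      moreover have "F z = m (Q z)"
        unfolding m_def by (rule arg_cong[OF 2])
      ultimately show ?thesis using solve_down[of "\<i> * s (Q z)"] nz by simp
    qed
    then show "\<exists>s s'. (\<lambda>n. of_real (d n) * Q z ^ n) sums s \<and>
            (\<lambda>n. of_real (c n) * Q z ^ n) sums s' \<and> F z = s + (z - of_real x0) * s'"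
      using d[of "Q z"] c[of "Q z"] Qz by (intro exI conjI) auto
  qed
qed

section \<open>Symmetrically analytic functions are regular\<close>

text \<open>
  The terms of the series at one point \<open>z1\<close> with \<open>Q z1 \<noteq> 0\<close> are bounded. By Abel's lemma the
  coefficients with even index and those with odd index then define power series that converge on the
  disc of radius \<open>\<bar>Q z1\<bar>\<close>, and \<open>Q z0 = 0\<close> is the centre of this disc.
\<close>

lemma quadratic_series_field_differentiable:
  fixes x0 y0 :: real and A :: "nat \<Rightarrow> complex"
  defines "z0 \<equiv> Complex x0 y0" and "Q \<equiv> \<lambda>z. (z - of_real x0)\<^sup>2 + of_real (y0\<^sup>2)"
  assumes V: "open V" "z0 \<in> V"
    and G: "\<And>z. z \<in> V \<Longrightarrow> (\<lambda>n. Q z ^ (n div 2) * (if even n then 1 else z - z0) * A n) sums G z"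
  shows "G field_differentiable at z0"
proof -
  have Q_factor: "Q z = (z - z0) * (z - cnj z0)" for z
    by (simp add: Q_def z0_def complex_eq_iff power2_eq_square algebra_simps)
  have "infinite V"
    by (rule infinite_openin[of UNIV V z0]) (use V in auto)
  then have "\<not> V \<subseteq> {z0, cnj z0}"
    using finite_subset by blast
  then obtain z1 where z1: "z1 \<in> V" "z1 \<noteq> z0" "z1 \<noteq> cnj z0"
    by blast
  define K where "K = norm (Q z1)"
  have K: "K > 0"
    using z1 by (simp add: K_def Q_factor)
  have "Bseq (\<lambda>n. Q z1 ^ (n div 2) * (if even n then 1 else z1 - z0) * A n)"
    using G[OF z1(1)] by (intro convergent_imp_Bseq convergentI[OF summable_LIMSEQ_zero] sums_summable)
  then obtain M where M: "\<And>n. norm (Q z1 ^ (n div 2) * (if even n then 1 else z1 - z0) * A n) \<le> M"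
    by (auto simp: Bseq_def)
  define E where "E w = (\<Sum>n. A (2 * n) * w ^ n)" for w
  define O' where "O' w = (\<Sum>n. A (2 * n + 1) * w ^ n)" for w
  have sum_E: "summable (\<lambda>n. A (2 * n) * w ^ n)" if "norm w < K" for w
  proof (rule summable_norm_cancel)
    have "norm (A (2 * n)) * K ^ n \<le> M" for n
      using M[of "2 * n"] by (simp add: norm_mult norm_power K_def mult.commute)
    from Abel_lemma[OF norm_ge_zero that this]
    show "summable (\<lambda>n. norm (A (2 * n) * w ^ n))"
      by (simp add: norm_mult norm_power)
  qed
  have sum_O: "summable (\<lambda>n. A (2 * n + 1) * w ^ n)" if "norm w < K" for w
  proof (rule summable_norm_cancel)
    have "norm (A (2 * n + 1)) * K ^ n \<le> M / norm (z1 - z0)" for n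
      using M[of "2 * n + 1"] z1(2) by (simp add: pos_le_divide_eq norm_mult norm_power K_def mult_ac)
    from Abel_lemma[OF norm_ge_zero that this]
    show "summable (\<lambda>n. norm (A (2 * n + 1) * w ^ n))"
      by (simp add: norm_mult norm_power)
  qed
  have Q0: "Q z0 = 0"
    by (simp add: Q_factor)
  have "(E has_field_derivative (\<Sum>n. diffs (\<lambda>n. A (2 * n)) n * 0 ^ n)) (at (Q z0))"
    unfolding Q0 E_def by (rule termdiffs_strong'[where K = K]) (use sum_E K in auto)
  moreover have "(O' has_field_derivative (\<Sum>n. diffs (\<lambda>n. A (2 * n + 1)) n * 0 ^ n)) (at (Q z0))"
    unfolding Q0 O'_def by (rule termdiffs_strong'[where K = K]) (use sum_O K in auto)
  moreover have Q_diff: "Q field_differentiable at z0"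
    unfolding Q_def by (intro derivative_intros)
  ultimately have "(\<lambda>z. E (Q z)) field_differentiable at z0" "(\<lambda>z. O' (Q z)) field_differentiable at z0"
    using field_differentiable_compose[OF Q_diff, unfolded o_def] by (auto simp: field_differentiable_def)
  then have diff: "(\<lambda>z. E (Q z) + O' (Q z) * (z - z0)) field_differentiable at z0"
    by (intro derivative_intros)
  define W where "W = V \<inter> {z. norm (Q z) < K}"
  have "open W"
    unfolding W_def Q_def by (intro open_Int V open_Collect_less continuous_intros)
  then obtain e where e: "e > 0" "ball z0 e \<subseteq> W"
    using V K open_contains_ball unfolding W_def by (metis (mono_tags, lifting) IntI Q0 mem_Collect_eq norm_zero)
  show ?thesis
  proof (rule field_differentiable_transform_within[OF e(1) _ _ diff])
    fix z assume "dist z z0 < e"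
    with e have z: "z \<in> V" "norm (Q z) < K"
      by (auto simp: W_def dist_commute)
    have "(\<lambda>n. A (2 * n) * Q z ^ n) sums E (Q z)"
      using sum_E[OF z(2)] by (simp add: E_def summable_sums)
    moreover have "(\<lambda>n. A (2 * n + 1) * Q z ^ n * (z - z0)) sums (O' (Q z) * (z - z0))"
      using sum_O[OF z(2)] unfolding O'_def by (intro sums_mult2 summable_sums)
    ultimately have "(\<lambda>n. if even n then A (2 * (n div 2)) * Q z ^ (n div 2)
        else A (2 * (n div 2) + 1) * Q z ^ (n div 2) * (z - z0)) sums (E (Q z) + O' (Q z) * (z - z0))"
      by (rule sums_interleave)
    also have "(\<lambda>n. if even n then A (2 * (n div 2)) * Q z ^ (n div 2)
        else A (2 * (n div 2) + 1) * Q z ^ (n div 2) * (z - z0)) =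
        (\<lambda>n. Q z ^ (n div 2) * (if even n then 1 else z - z0) * A n)"
      by (auto simp: fun_eq_iff)
    finally show "E (Q z) + O' (Q z) * (z - z0) = G z"
      using G[OF z(1)] sums_unique2 by blast
  qed auto
qed

lemma quadratic_slice_embed:
  assumes "J \<in> imag_units"
  shows "(slice_embed J z - of_real x0)\<^sup>2 + of_real (y0\<^sup>2) =
    slice_embed J ((z - of_real x0)\<^sup>2 + of_real (y0\<^sup>2))"
proof -
  have "slice_embed J z - of_real x0 = slice_embed J (z - of_real x0)"
    by (simp add: slice_embed_diff)
  then show ?thesis
    by (simp only: slice_embed_add slice_embed_power[OF assms] slice_embed_real)
qed

theorem symmetrically_analytic_imp_slice_regular:
  assumes "symmetrically_analytic_on \<Omega> f"
  shows "slice_regular_on \<Omega> f"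
  unfolding slice_regular_on_iff
proof safe
  fix I z v assume I: "I \<in> imag_units" and z: "slice_embed I z \<in> \<Omega>"
  define x0 y0 where "x0 = Re z" and "y0 = Im z"
  have z_eq: "z = Complex x0 y0"
    by (simp add: x0_def y0_def)
  have pt: "slice_point I x0 y0 = slice_embed I z"
    by (simp add: z_eq slice_point_eq_embed)
  have "slice_point I x0 y0 \<in> \<Omega>"
    using z by (simp only: pt)
  then obtain A U where U: "open U" "slice_point I x0 y0 \<in> U"
      and sums: "\<And>q. q \<in> U \<Longrightarrow> (\<lambda>n. sym_poly I x0 y0 n q * A n) sums f q"
    using assms I unfolding symmetrically_analytic_on_def by meson
  define P where
    "P n w = ((w - of_real x0)\<^sup>2 + of_real (y0\<^sup>2)) ^ (n div 2) * (if even n then 1 else w - Complex x0 y0)"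
    for n w
  have P: "sym_poly I x0 y0 n (slice_embed I w) = slice_embed I (P n w)" for n w
    using slice_embed_real[of I 1]
    unfolding sym_poly_def P_def quadratic_slice_embed[OF I] slice_embed_mult[OF I]
      slice_embed_power[OF I]
    by (simp add: pt z_eq slice_embed_diff)
  define V where "V = slice_embed I -` U"
  have "open V"
    unfolding V_def using U(1) bounded_linear.isCont[OF bounded_linear_slice_embed] by (intro open_vimage)
      (auto intro: linear_continuous_on[OF bounded_linear_slice_embed])
  moreover have "Complex x0 y0 \<in> V"
    using U(2) by (simp add: V_def slice_point_eq_embed)
  moreover have "(\<lambda>n. P n w * slice_functional I v (A n)) sums slice_functional I v (f (slice_embed I w))"
    if "w \<in> V" for w
  proof -
    have "(\<lambda>n. slice_embed I (P n w) * A n) sums f (slice_embed I w)"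
      using sums[of "slice_embed I w"] that by (simp add: V_def P)
    from bounded_linear.sums[OF bounded_linear_slice_functional[of I v] this]
    show ?thesis
      by (simp only: slice_functional_embed_mult[OF I])
  qed
  ultimately have "(\<lambda>w. slice_functional I v (f (slice_embed I w))) field_differentiable at (Complex x0 y0)"
    unfolding P_def by (rule quadratic_series_field_differentiable)
  then show "(\<lambda>w. slice_functional I v (f (slice_embed I w))) field_differentiable at z"
    by (simp only: z_eq)
qed

section \<open>Regular functions are symmetrically analytic\<close>

lemma real_islimpt_open:
  assumes "open D" "of_real a \<in> (D :: complex set)"
  shows "of_real a islimpt (D \<inter> \<real>)"
proof -
  have "complex_of_real a islimpt \<real>"
    unfolding islimpt_approachable
  proof safe
    fix e :: real assume "e > 0"
    then show "\<exists>x'\<in>\<real>. x' \<noteq> complex_of_real a \<and> dist x' (complex_of_real a) < e"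
      by (intro bexI[of _ "of_real (a + e / 2)"]) (auto simp: dist_norm simp flip: of_real_diff)
  qed
  then show ?thesis
    unfolding islimpt_def using assms
    by (metis (no_types, lifting) Int_iff open_Int)
qed

text \<open>
  The slices of \<open>\<Omega>\<close> are all described by one subset \<open>D\<close> of the complex plane, by symmetry, and
  \<open>D\<close> is connected and meets the real axis because \<open>\<Omega>\<close> is a slice domain. The functions \<open>F e\<close> are
  built from a single slice. The identity theorem transfers the representation of \<open>f\<close> to every other
  slice, since all slices share the real points. The factor \<open>e\<close> stands on the right in order not to
  interfere with the left multiplication by slice elements.
\<close>

lemma slice_regular_real_components:
  assumes \<Omega>: "slice_domain \<Omega>" "slice_symmetric \<Omega>" and f: "slice_regular_on \<Omega> f"
  obtains D :: "complex set" and F :: "quat \<Rightarrow> complex \<Rightarrow> complex"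
  where "open D"
    and "\<And>J z. J \<in> imag_units \<Longrightarrow> slice_embed J z \<in> \<Omega> \<longleftrightarrow> z \<in> D"
    and "\<And>z. z \<in> D \<Longrightarrow> cnj z \<in> D"
    and "\<And>e. F e holomorphic_on D"
    and "\<And>e z. F e (cnj z) = cnj (F e z)"
    and "\<And>J z. J \<in> imag_units \<Longrightarrow> z \<in> D \<Longrightarrow>
           f (slice_embed J z) = (\<Sum>e\<in>Basis. slice_embed J (F e z) * e)"
proof
  define I where "I = Quat 0 1 0 0"
  have I: "I \<in> imag_units"
    unfolding I_def by (rule imag_units_nonempty)
  define D where "D = {z. slice_embed I z \<in> \<Omega>}"
  show D_iff: "slice_embed J z \<in> \<Omega> \<longleftrightarrow> z \<in> D" if "J \<in> imag_units" for J z
    using \<Omega>(2) I that unfolding slice_symmetric_def D_def slice_embed_def by blast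
  have "open \<Omega>"
    using \<Omega>(1) by (simp add: slice_domain_def)
  then have "open (slice_embed I -` \<Omega>)"
    by (rule open_vimage) (rule linear_continuous_on[OF bounded_linear_slice_embed])
  then show D: "open D"
    by (simp add: D_def vimage_def)
  show cnj_D: "cnj z \<in> D" if "z \<in> D" for z
    using that D_iff[OF uminus_imag_unit[OF I], of z] D_iff[OF I, of "cnj z"] by (simp add: slice_embed_cnj)
  \<comment> \<open>\<open>slice_functional I 1\<close> inverts \<open>slice_embed I\<close>, so \<open>D\<close> is a continuous image of a connected set.\<close>
  have retract: "slice_functional I 1 (slice_embed I z) = z" for z
  proof -
    have "slice_functional I 1 1 = 1"
      using I by (simp add: slice_functional_def imag_units_iff inner_quat_def complex_eq_iff)
    then show ?thesis
      using slice_functional_embed_mult[OF I, of 1 z 1] by simp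
  qed
  have "connected (\<Omega> \<inter> slice I)"
    using \<Omega>(1) I by (simp add: slice_domain_def)
  then have "connected (slice_functional I 1 ` (\<Omega> \<inter> slice I))"
    by (rule connected_continuous_image[rotated])
      (rule linear_continuous_on[OF bounded_linear_slice_functional])
  also have "slice_functional I 1 ` (\<Omega> \<inter> slice I) = D"
    by (auto simp: D_def slice_eq_range retract image_iff) (metis IntI rangeI retract)
  finally have conn: "connected D" .
  have "\<Omega> \<inter> \<real> \<noteq> {}"
    using \<Omega>(1) by (simp add: slice_domain_def)
  then obtain a where "of_real a \<in> \<Omega>"
    by (auto elim: Reals_cases)
  then have a: "of_real a \<in> D"
    by (simp add: D_def)
  have holo: "(\<lambda>z. slice_functional J v (f (slice_embed J z))) holomorphic_on D" if "J \<in> imag_units" for J v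
    unfolding holomorphic_on_def
  proof (rule ballI, rule field_differentiable_at_within)
    fix z assume "z \<in> D"
    then have "slice_embed J z \<in> \<Omega>"
      using D_iff[OF that] by simp
    with f that show "(\<lambda>z. slice_functional J v (f (slice_embed J z))) field_differentiable at z"
      unfolding slice_regular_on_iff by blast
  qed
  define g where "g e z = slice_functional I e (f (slice_embed I z))" for e z
  define F where "F e z = (g e z + cnj (g e (cnj z))) / 2" for e z
  have "cnj ` D = D"
    using cnj_D by (auto simp: image_iff) (metis complex_cnj_cnj)
  then have "(\<lambda>z. cnj (g e (cnj z))) holomorphic_on D" for e
    using holomorphic_on_compose_cnj_cnj[of "g e" D] holo[OF I, of e] D by (simp add: g_def[abs_def] o_def)
  moreover have "g e holomorphic_on D" for e
    unfolding g_def by (rule holo[OF I])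
  ultimately show F_holo: "F e holomorphic_on D" for e
    unfolding F_def by (intro holomorphic_intros) auto
  show "F e (cnj z) = cnj (F e z)" for e z
    by (simp add: F_def)
  fix J z assume J: "J \<in> imag_units" and z: "z \<in> D"
  show "f (slice_embed J z) = (\<Sum>e\<in>Basis. slice_embed J (F e z) * e)"
  proof (rule slice_functional_eqI[of J])
    fix v :: quat
    have lin: "slice_functional J v (\<Sum>e\<in>Basis. slice_embed J (F e z) * e) =
        (\<Sum>e\<in>Basis. F e z * slice_functional J v e)" for z
      by (simp add: linear_sum[OF bounded_linear.linear[OF bounded_linear_slice_functional]]
          slice_functional_embed_mult[OF J])
    define h where "h z = slice_functional J v (f (slice_embed J z)) - (\<Sum>e\<in>Basis. F e z * slice_functional J v e)" for z
    have h_holo: "h holomorphic_on D"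
      unfolding h_def by (intro holomorphic_intros holo[OF J] F_holo)
    have h_zero: "h z = 0" if "z \<in> D \<inter> \<real>" for z
    proof -
      from that obtain x where x: "z = of_real x"
        by (auto elim: Reals_cases)
      have "F e z = of_real (inner (f (of_real x)) e)" for e
        by (simp add: F_def g_def x complex_add_cnj slice_functional_def)
      then have "(\<Sum>e\<in>Basis. slice_embed J (F e z) * e) = f (of_real x)"
        using euclidean_representation[of "f (of_real x)"]
        by (simp add: scaleR_conv_of_real)
      then show ?thesis
        by (simp add: h_def x flip: lin)
    qed
    have "h z = 0"
      by (rule analytic_continuation[OF h_holo D conn Int_lower1 a real_islimpt_open[OF D a] h_zero z])
    then show "slice_functional J v (f (slice_embed J z)) =
        slice_functional J v (\<Sum>e\<in>Basis. slice_embed J (F e z) * e)"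
      by (simp add: h_def lin)
  qed
qed

text \<open>
  The coefficients depend on the centre, but not on the slice \<open>J\<close> of the point of evaluation: an
  expansion in powers of \<open>Q z\<close> with real, hence central, coefficients can be
  transported to any slice. The summand
  \<open>(q\<^sub>0 - x\<^sub>0) c\<^sub>n\<close> in the even coefficients comes from \<open>q - x\<^sub>0 = (q - q\<^sub>0) + (q\<^sub>0 - x\<^sub>0)\<close>.
\<close>

lemma sym_poly_expansion_of_intrinsic:
  assumes J: "J \<in> imag_units"
    and s: "(\<lambda>n. of_real (d n) * ((z - of_real x0)\<^sup>2 + of_real (y0\<^sup>2)) ^ n) sums s"
    and t: "(\<lambda>n. of_real (c n) * ((z - of_real x0)\<^sup>2 + of_real (y0\<^sup>2)) ^ n) sums t"
  shows "(\<lambda>n. sym_poly I x0 y0 n (slice_embed J z) *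
      (if even n then of_real (d (n div 2)) + (slice_point I x0 y0 - of_real x0) * of_real (c (n div 2))
       else of_real (c (n div 2)))) sums slice_embed J (s + (z - of_real x0) * t)"
proof -
  define q where "q = slice_embed J z"
  define q0 where "q0 = slice_point I x0 y0"
  define Q where "Q = (q - of_real x0)\<^sup>2 + of_real (y0\<^sup>2)"
  have central: "of_real r * p = p * of_real r" for r and p :: quat
    by (simp add: of_real_def)
  have embed: "slice_embed J (of_real r * ((z - of_real x0)\<^sup>2 + of_real (y0\<^sup>2)) ^ n) = Q ^ n * of_real r" for r n
    unfolding Q_def q_def quadratic_slice_embed[OF J] slice_embed_mult[OF J] slice_embed_power[OF J]
    by (simp add: central)
  have S: "(\<lambda>n. Q ^ n * of_real (d n)) sums slice_embed J s"
    using bounded_linear.sums[OF bounded_linear_slice_embed[of J] s] by (simp only: embed)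
  have T: "(\<lambda>n. Q ^ n * of_real (c n)) sums slice_embed J t"
    using bounded_linear.sums[OF bounded_linear_slice_embed[of J] t] by (simp only: embed)
  have "(\<lambda>n. Q ^ n * (of_real (d n) + (q0 - of_real x0) * of_real (c n))) sums
      (slice_embed J s + slice_embed J t * (q0 - of_real x0))"
    using sums_add[OF S sums_mult2[OF T, of "q0 - of_real x0"]]
    by (simp only: mult.assoc central distrib_left)
  moreover have "(\<lambda>n. Q ^ n * (q - q0) * of_real (c n)) sums (slice_embed J t * (q - q0))"
    using sums_mult2[OF T, of "q - q0"] by (simp only: mult.assoc central)
  ultimately have "(\<lambda>n. if even n then Q ^ (n div 2) * (of_real (d (n div 2)) + (q0 - of_real x0) * of_real (c (n div 2)))
      else Q ^ (n div 2) * (q - q0) * of_real (c (n div 2))) sums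
      (slice_embed J s + slice_embed J t * (q0 - of_real x0) + slice_embed J t * (q - q0))"
    by (rule sums_interleave)
  also have "slice_embed J s + slice_embed J t * (q0 - of_real x0) + slice_embed J t * (q - q0) =
      slice_embed J s + slice_embed J t * (q - of_real x0)"
    by (simp add: algebra_simps)
  also have "\<dots> = slice_embed J (s + t * (z - of_real x0))"
    by (simp add: slice_embed_add slice_embed_mult[OF J] slice_embed_diff q_def)
  also have "s + t * (z - of_real x0) = s + (z - of_real x0) * t"
    by simp
  finally show ?thesis
    by (rule sums_cong[THEN iffD1, rotated]) (simp add: sym_poly_def q_def q0_def Q_def)
qed

theorem slice_regular_imp_symmetrically_analytic:
  assumes "slice_domain \<Omega>" "slice_symmetric \<Omega>" "slice_regular_on \<Omega> f"
  shows "symmetrically_analytic_on \<Omega> f"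
proof -
  from assms obtain D F where D: "open D"
    and D_iff: "\<And>J z. J \<in> imag_units \<Longrightarrow> slice_embed J z \<in> \<Omega> \<longleftrightarrow> z \<in> D"
    and cnj_D: "\<And>z. z \<in> D \<Longrightarrow> cnj z \<in> D"
    and F: "\<And>e. F e holomorphic_on D"
    and cnj_F: "\<And>e z. F e (cnj z) = cnj (F e z)"
    and f_eq: "\<And>J z. J \<in> imag_units \<Longrightarrow> z \<in> D \<Longrightarrow>
           f (slice_embed J z) = (\<Sum>e\<in>Basis. slice_embed J (F e z) * e)"
    by (rule slice_regular_real_components) blast
  show ?thesis
    unfolding symmetrically_analytic_on_def
  proof safe
    fix I x0 y0 assume I: "I \<in> imag_units" and q0: "slice_point I x0 y0 \<in> \<Omega>"
    define Q :: "complex \<Rightarrow> complex" where "Q z = (z - of_real x0)\<^sup>2 + of_real (y0\<^sup>2)" for z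
    have z0: "Complex x0 y0 \<in> D"
      using q0 by (simp add: slice_point_eq_embed D_iff[OF I])
    \<comment> \<open>the radius and the coefficients depend on \<open>e\<close>; naming the relation lets them be chosen as functions of \<open>e\<close>\<close>
    define expands where "expands e r d c \<longleftrightarrow> r > 0 \<and> (\<forall>z. norm (Q z) < r \<longrightarrow> z \<in> D \<and>
        (\<exists>s t. (\<lambda>n. of_real (d n) * Q z ^ n) sums s \<and>
            (\<lambda>n. of_real (c n) * Q z ^ n) sums t \<and> F e z = s + (z - of_real x0) * t))"
      for e and r :: real and d c :: "nat \<Rightarrow> real"
    have "\<exists>r d c. expands e r d c" for e
      unfolding expands_def
      by (rule intrinsic_quadratic_expansion[OF D F[of e] cnj_D cnj_F z0]) (unfold Q_def, blast+)
    then obtain r d c where "\<And>e. expands e (r e) (d e) (c e)"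
      by metis
    then have r: "\<And>e. r e > 0"
      and in_D: "\<And>e z. norm (Q z) < r e \<Longrightarrow> z \<in> D"
      and exp: "\<And>e z. norm (Q z) < r e \<Longrightarrow>
        \<exists>s t. (\<lambda>n. of_real (d e n) * Q z ^ n) sums s \<and>
            (\<lambda>n. of_real (c e n) * Q z ^ n) sums t \<and> F e z = s + (z - of_real x0) * t"
      unfolding expands_def by blast+
    define A where "A e n = (if even n then of_real (d e (n div 2)) + (slice_point I x0 y0 - of_real x0) * of_real (c e (n div 2))
       else of_real (c e (n div 2)) :: quat)" for e :: quat and n
    \<comment> \<open>a radius that works for all four components\<close>
    define \<rho> where "\<rho> = Min (r ` (Basis :: quat set))"
    have \<rho>: "\<rho> > 0"
      using r by (simp add: \<rho>_def)
    have \<rho>_less: "norm (Q z) < r e" if "norm (Q z) < \<rho>" "e \<in> Basis" for z e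
      using that by (simp add: \<rho>_def)
    define U where "U = {q :: quat. norm ((q - of_real x0)\<^sup>2 + of_real (y0\<^sup>2)) < \<rho>}"
    have U_embed: "slice_embed J z \<in> U \<longleftrightarrow> norm (Q z) < \<rho>" if "J \<in> imag_units" for J z
      unfolding U_def mem_Collect_eq quadratic_slice_embed[OF that] norm_slice_embed[OF that] Q_def ..
    have U_D: "z \<in> D" if "norm (Q z) < \<rho>" for z
      using that in_D \<rho>_less nonempty_Basis by blast
    have U_open: "open U"
      unfolding U_def by (intro open_Collect_less continuous_intros)
    have U_q0: "slice_point I x0 y0 \<in> U"
      using \<rho> unfolding slice_point_eq_embed U_embed[OF I]
      by (simp add: Q_def Complex_eq power_mult_distrib)
    have U_sub: "U \<subseteq> \<Omega>"
    proof
      fix q assume "q \<in> U"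
      obtain J z where "J \<in> imag_units" "slice_embed J z = q"
        by (rule quat_in_some_slice)
      with \<open>q \<in> U\<close> show "q \<in> \<Omega>"
        using U_embed U_D D_iff by metis
    qed
    have U_sums: "(\<lambda>n. sym_poly I x0 y0 n q * (\<Sum>e\<in>Basis. A e n * e)) sums f q" if "q \<in> U" for q
    proof -
      obtain J z where J: "J \<in> imag_units" and q: "slice_embed J z = q"
        by (rule quat_in_some_slice)
      have Qz: "norm (Q z) < \<rho>"
        using \<open>q \<in> U\<close> U_embed[OF J, of z] by (simp add: q)
      have "(\<lambda>n. sym_poly I x0 y0 n q * A e n) sums slice_embed J (F e z)" if e: "e \<in> Basis" for e
      proof -
        obtain s t where st: "(\<lambda>n. of_real (d e n) * Q z ^ n) sums s"
            "(\<lambda>n. of_real (c e n) * Q z ^ n) sums t" "F e z = s + (z - of_real x0) * t"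
          using exp[OF \<rho>_less[OF Qz e]] by blast
        show ?thesis
          using sym_poly_expansion_of_intrinsic[OF J st(1,2)[unfolded Q_def], of I]
          unfolding A_def st(3) q .
      qed
      then have "(\<lambda>n. \<Sum>e\<in>Basis. sym_poly I x0 y0 n q * A e n * e) sums (\<Sum>e\<in>Basis. slice_embed J (F e z) * e)"
        by (intro sums_sum sums_mult2)
      then show ?thesis
        using f_eq[OF J U_D[OF Qz]] by (simp add: q sum_distrib_left mult.assoc)
    qed
    show "\<exists>A U. open U \<and> slice_point I x0 y0 \<in> U \<and> U \<subseteq> \<Omega> \<and>
           (\<forall>q\<in>U. (\<lambda>n. sym_poly I x0 y0 n q * A n) sums f q)"
      using U_open U_q0 U_sub
      by (intro exI[of _ "\<lambda>n. \<Sum>e\<in>Basis. A e n * e"] exI[of _ U] conjI ballI U_sums)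
  qed
qed

theorem corollary4p3:
  fixes \<Omega> :: "quat set" and f :: "quat \<Rightarrow> quat"
  assumes "slice_domain \<Omega>" and "slice_symmetric \<Omega>"
  shows "slice_regular_on \<Omega> f \<longleftrightarrow> symmetrically_analytic_on \<Omega> f"
  using slice_regular_imp_symmetrically_analytic[OF assms] symmetrically_analytic_imp_slice_regular by blast

end
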